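(* Let $a\in\mathbb{Z}$, $0<x<1$, and $\tau$ in the complex upper half-plane. Then $$\sum_{\varepsilon\in\{\pm1\}}\varepsilon\,\mathcal{E}_{2-2a}\left(\frac{(1-2x)(1+\varepsilon\tau)+\tau+1}{2};\tau\right)=-\tau^{2a-2}\sum_{\varepsilon\in\{\pm1\}}\varepsilon\,\mathcal{E}_{2-2a}\left(\frac{(1-2x)\left(1-\varepsilon\frac1\tau\right)-\frac1\tau+1}{2};-\frac1\tau\right)+2(2\pi i)^{2a-1}\sum_{n=0}^{a-1}\frac{B_{2n+1}(x)B_{2a-1-2n}(x)}{(2n+1)!\,(2a-1-2n)!}\,\tau^{2n},$$ where the last sum is empty (equal to $0$) if $a\le0$.
   Context: For $b\in\mathbb{Z}$, $\tau=u+iv$ with $v>0$, and $z$ with $0<\operatorname{Im}(z)<v$, put $q=e^{2\pi i\tau}$, $\zeta=e^{2\pi i z}$ and $$\mathcal{E}_{2-b}(z;\tau)=\sum_{n\in\mathbb{Z}\setminus\{0\}}\frac{\zeta^n}{n^{b-1}(1-q^n)};$$ in the claim this is used with $b=2a$. $B_n(t)$ is the $n$-th Bernoulli polynomial. *)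

theory Defs
  imports
    "HOL-Analysis.Analysis"
    "HOL-Computational_Algebra.Formal_Power_Series"
begin

text \<open>
  Bernoulli polynomials by their generating function
  \<open>t e^(x t) / (e^t - 1) = (\<Sum>n. B_n(x) t^n / n!)\<close>. The quotient is taken in the ring of formal
  power series, where numerator and denominator both have order at least 1.
\<close>

definition bernpoly :: "nat \<Rightarrow> 'a :: field_char_0 \<Rightarrow> 'a" where
  "bernpoly n x = fact n * fps_nth (fps_X * fps_exp x / (fps_exp 1 - 1)) n"

text \<open>
  The function \<open>\<E>_k(z;\<tau>)\<close>, with \<open>k = 2 - b\<close>, so that the exponent \<open>b - 1\<close> of \<open>n\<close> is
  \<open>1 - k\<close>. The series converges absolutely for \<open>0 < Im z < Im \<tau>\<close>; the value of the total
  function \<open>calE\<close> outside this domain carries no meaning.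
\<close>

definition calE :: "int \<Rightarrow> complex \<Rightarrow> complex \<Rightarrow> complex" where
  "calE k z \<tau> =
     (let q = exp (2 * of_real pi * \<i> * \<tau>); \<zeta> = exp (2 * of_real pi * \<i> * z)
      in \<Sum>\<^sub>\<infinity>n\<in>UNIV - {0::int}. \<zeta> powi n / (of_int n powi (1 - k) * (1 - q powi n)))"

end

theory Submission
  imports Defs "HOL-Complex_Analysis.Complex_Analysis"
begin

text \<open>
  Put \<open>G(t) = (e^((1-x)t) - e^(xt)) / (e^t - 1)\<close>. Integrate
  \<open>w^(1-2a) G(2\<pi>\<i>w) G(2\<pi>\<i>\<tau>w)\<close> over the boundaries of growing rectangles. The residues at the nonzero
  integers \<open>n\<close> add up to \<open>-1/(\<pi>\<i>)\<close> times the left-hand side, those at \<open>m/\<tau>\<close> to \<open>-\<tau>^(2a-2)/(\<pi>\<i>)\<close> times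
  the corresponding sum for \<open>-1/\<tau>\<close>. The residue at \<open>0\<close> gives the Bernoulli sum, since the
  coefficients of \<open>t G(t)\<close> are \<open>(B_n(1-x) - B_n(x))/n!\<close>. The integrals tend to \<open>0\<close>: \<open>G(t)\<close> decays
  exponentially in \<open>\<bar>Re t\<bar>\<close>, and the lines \<open>Im w = 0\<close> and \<open>Im \<tau>w = 0\<close> meet only at \<open>0\<close>.
\<close>

subsection \<open>Bernoulli polynomials and the kernel\<close>

text \<open>The numerator of \<open>kern\<close> vanishes at 0 as well, so \<open>kern\<close> has
  only a removable singularity there and the pole at 0 comes from \<open>w powi (1 - 2 * a)\<close>
  alone; hence the empty sum for a \<le> 0. The other poles, the nonzero n and m/\<tau>, never
  coincide because m/\<tau> is not real, and all of them are at most simple. The integrand is odd,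
  so its residues at p and -p agree: the residue at n combines the terms of index n and -n of the
  series, and summing over both signs counts every term twice. The obstacle is the estimate on
  contours that must pass between poles on two different lines. Each factor fails to decay near its
  own line of poles. The contour crosses that line halfway between two poles, where the factor stays
  bounded, and the other factor supplies the decay.\<close>

text \<open>Equal to \<open>sinh ((1/2 - x) t) / sinh (t/2)\<close>, with junk value \<open>0\<close> where \<open>e^t = 1\<close>.\<close>

definition kern :: "real \<Rightarrow> complex \<Rightarrow> complex" where
  "kern x t = (exp ((1 - of_real x) * t) - exp (of_real x * t)) / (exp t - 1)"

lemma fps_exp_1_minus_1:
  "(fps_exp 1 - 1 :: 'a :: field_char_0 fps) \<noteq> 0" "subdegree (fps_exp 1 - 1 :: 'a fps) = 1"
proof -
  show "subdegree (fps_exp 1 - 1 :: 'a fps) = 1"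
    by (rule subdegreeI) auto
  thus "(fps_exp 1 - 1 :: 'a :: field_char_0 fps) \<noteq> 0" by auto
qed

text \<open>The divisor has constant term 0 and is not a unit; the quotient is exact because the
  numerator also has subdegree 1.\<close>

lemma bernpoly_fps_eq:
  "Abs_fps (\<lambda>n. bernpoly n x / fact n) * (fps_exp 1 - 1) = fps_X * fps_exp (x :: 'a :: field_char_0)"
proof -
  have "Abs_fps (\<lambda>n. bernpoly n x / fact n) = fps_X * fps_exp x / (fps_exp 1 - 1)"
    by (simp add: fps_eq_iff bernpoly_def)
  moreover have "(fps_exp 1 - 1) dvd (fps_X * fps_exp x)"
    by (subst fps_dvd_iff) (simp_all only: fps_exp_1_minus_1, simp_all)
  ultimately show ?thesis by simp
qed

text \<open>Cancellation in the integral domain of power series: properties of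
  \<open>bernpoly\<close> can now be read off from product identities, without the quotient.\<close>

lemma bernpoly_unique:
  assumes "Abs_fps f * (fps_exp 1 - 1) = fps_X * fps_exp (x :: 'a :: field_char_0)"
  shows "bernpoly n x = fact n * f n"
proof -
  have "Abs_fps f = Abs_fps (\<lambda>n. bernpoly n x / fact n)"
    using assms bernpoly_fps_eq[of x] fps_exp_1_minus_1(1) by (metis mult_right_cancel)
  thus ?thesis by (simp add: fps_eq_iff)
qed

lemma of_real_bernpoly:
  "of_real (bernpoly n x) = (bernpoly n (of_real x) :: 'a :: {field_char_0, real_field})"
proof -
  have "Abs_fps (\<lambda>n. of_real (bernpoly n x / fact n) :: 'a) * (fps_exp 1 - 1) = fps_X * fps_exp (of_real x)"
  proof (rule fps_ext)
    fix n
    have "of_real (fps_nth (Abs_fps (\<lambda>n. bernpoly n x / fact n) * (fps_exp 1 - 1)) n)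
            = (of_real (fps_nth (fps_X * fps_exp x) n) :: 'a)"
      by (simp only: bernpoly_fps_eq)
    thus "fps_nth (Abs_fps (\<lambda>n. of_real (bernpoly n x / fact n) :: 'a) * (fps_exp 1 - 1)) n
           = fps_nth (fps_X * fps_exp (of_real x)) n"
      by (cases n) (auto simp: fps_mult_nth[of "Abs_fps _"])
  qed
  from bernpoly_unique[OF this, of n] show ?thesis by simp
qed

text \<open>Replace t by -t in the generating function and multiply by e^t: this turns e^(-t) - 1
  into 1 - e^t and e^(-xt) into e^((1-x)t).\<close>

lemma bernpoly_one_minus: "bernpoly n (1 - x) = (-1) ^ n * bernpoly n (x :: 'a :: field_char_0)"
proof -
  have "(Abs_fps (\<lambda>n. bernpoly n x / fact n) * (fps_exp 1 - 1)) oo (-fps_X) =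
          (fps_X * fps_exp x) oo (-fps_X)"
    by (simp only: bernpoly_fps_eq)
  hence "(Abs_fps (\<lambda>n. bernpoly n x / fact n) oo (-fps_X)) * (fps_exp (-1) - 1) = - fps_X * fps_exp (-x)"
    by (simp add: fps_compose_mult_distrib fps_compose_sub_distrib)
  hence "(Abs_fps (\<lambda>n. bernpoly n x / fact n) oo (-fps_X)) * ((fps_exp (-1) - 1) * fps_exp 1) =
           - fps_X * (fps_exp (-x) * fps_exp 1)"
    by (simp only: mult.assoc[symmetric])
  moreover have "(fps_exp (-1) - 1) * fps_exp 1 = (1 - fps_exp 1 :: 'a fps)"
    by (simp add: algebra_simps flip: fps_exp_add_mult)
  moreover have "fps_exp (-x) * fps_exp 1 = fps_exp (1 - x)"
    by (simp flip: fps_exp_add_mult)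
  ultimately have "(Abs_fps (\<lambda>n. bernpoly n x / fact n) oo (-fps_X)) * (1 - fps_exp 1) =
           - (fps_X * fps_exp (1 - x))" by simp
  hence "Abs_fps (\<lambda>n. (-1) ^ n * (bernpoly n x / fact n)) * (fps_exp 1 - 1) = fps_X * fps_exp (1 - x)"
    by (simp add: fps_compose_uminus' algebra_simps)
  from bernpoly_unique[OF this, of n] show ?thesis by simp
qed

text \<open>The Taylor coefficients (B_(n+1)(1-x) - B_(n+1)(x))/(n+1)! of the kernel at 0,
  simplified by the reflection formula, which doubles the even ones and kills the odd ones.\<close>

definition kern_coeff :: "real \<Rightarrow> nat \<Rightarrow> complex" where
  "kern_coeff x n = (if even n then - 2 * of_real (bernpoly (Suc n) x) / fact (Suc n) else 0)"

lemma kern_fps_eq: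
  "(fps_exp (1 - of_real x) - fps_exp (of_real x)) / (fps_exp 1 - 1) = Abs_fps (kern_coeff x)"
proof -
  let ?B = "\<lambda>x :: complex. Abs_fps (\<lambda>n. bernpoly n x / fact n)"
  have "fps_X * Abs_fps (kern_coeff x) = ?B (1 - of_real x) - ?B (of_real x)"
  proof (rule fps_ext)
    fix n
    have "bernpoly 0 y = 1" for y :: complex
    proof -
      have "fps_nth (?B y * (fps_exp 1 - 1)) 1 = fps_nth (fps_X * fps_exp y) 1"
        by (simp only: bernpoly_fps_eq)
      thus ?thesis by (simp add: fps_mult_nth)
    qed
    thus "fps_nth (fps_X * Abs_fps (kern_coeff x)) n = fps_nth (?B (1 - of_real x) - ?B (of_real x)) n"
      by (cases n) (auto simp: kern_coeff_def of_real_bernpoly bernpoly_one_minus field_simps)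
  qed
  hence "fps_X * Abs_fps (kern_coeff x) * (fps_exp 1 - 1) =
           ?B (1 - of_real x) * (fps_exp 1 - 1) - ?B (of_real x) * (fps_exp 1 - 1)"
    by (metis left_diff_distrib)
  hence "fps_X * Abs_fps (kern_coeff x) * (fps_exp 1 - 1) =
           fps_X * (fps_exp (1 - of_real x) - fps_exp (of_real x))"
    by (simp only: bernpoly_fps_eq) (simp only: right_diff_distrib)
  hence "Abs_fps (kern_coeff x) * (fps_exp 1 - 1) = fps_exp (1 - of_real x) - fps_exp (of_real x)"
    by (simp add: mult.assoc)
  thus ?thesis
    by (metis fps_exp_1_minus_1(1) nonzero_mult_div_cancel_right)
qed

text \<open>Division by zero makes \<open>kern x 0 = 0\<close>, so the removable singularity is
  filled with the limit 1 - 2x. The case x = 1/2 is separate: the numerator is then the zero series,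
  whose \<open>subdegree\<close> is 0 by convention, below that of the divisor.\<close>

lemma kern_has_fps_expansion:
  "(\<lambda>t. if t = 0 then 1 - 2 * of_real x else kern x t) has_fps_expansion Abs_fps (kern_coeff x)"
proof (cases "x = 1 / 2")
  case True
  hence "of_real (1 - x) = (of_real x :: complex)" by (intro arg_cong[of _ _ of_real]) simp
  hence x: "1 - of_real x = (of_real x :: complex)" by (simp only: of_real_diff of_real_1)
  hence "Abs_fps (kern_coeff x) = 0" by (simp only: kern_fps_eq[symmetric]) simp
  moreover have "(\<lambda>t. if t = 0 then 1 - 2 * of_real x else kern x t) = (\<lambda>_. 0)"
    unfolding kern_def x using x by (auto simp: algebra_simps)
  ultimately show ?thesis by (auto intro!: fps_expansion_intros)
next
  case False
  have nz: "1 - 2 * complex_of_real x \<noteq> 0"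
    using False by (metis eq_iff_diff_eq_0 mult.commute nonzero_eq_divide_eq of_real_1 of_real_divide of_real_eq_iff of_real_numeral zero_neq_numeral)
  have sd: "subdegree (fps_exp (1 - of_real x) - fps_exp (of_real x) :: complex fps) = 1"
    by (rule subdegreeI) (use nz in auto)
  have "(\<lambda>t. if t = 0 then 1 - 2 * of_real x else
           (exp ((1 - of_real x) * t) - exp (of_real x * t)) / (exp t - 1)) has_fps_expansion
          (fps_exp (1 - of_real x) - fps_exp (of_real x)) / (fps_exp 1 - 1 :: complex fps)"
  proof (rule has_fps_expansion_divide)
    show "1 - 2 * complex_of_real x =
      fps_nth (fps_exp (1 - of_real x) - fps_exp (of_real x)) (subdegree (fps_exp 1 - 1 :: complex fps)) /
      fps_nth (fps_exp 1 - 1) (subdegree (fps_exp 1 - 1 :: complex fps))"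
      unfolding fps_exp_1_minus_1 by simp
  qed (simp_all only: sd fps_exp_1_minus_1, auto intro!: fps_expansion_intros)
  thus ?thesis unfolding kern_fps_eq kern_def .
qed

text \<open>With the removable singularities filled, only the power of w can create a pole. For a
  \<ge> 1 the residue is the coefficient of degree 2a - 2 in the Cauchy product of the two
  expansions; the factor 4 is the product of the two factors -2 in
  \<open>kern_coeff\<close>.\<close>

lemma residue_kern_kern_0:
  assumes "c \<noteq> 0" "d \<noteq> 0"
  shows "residue (\<lambda>w. w powi (1 - 2 * a) * (kern x (c * w) * kern x (d * w))) 0 =
     4 * (\<Sum>n<nat a. of_real (bernpoly (2 * n + 1) x * bernpoly (2 * nat a - 1 - 2 * n) x)
                       / (fact (2 * n + 1) * fact (2 * nat a - 1 - 2 * n)) *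
                       d ^ (2 * n) * c ^ (2 * (nat a - 1 - n)))"
proof -
  define k where "k = (\<lambda>t. if t = 0 then 1 - 2 * of_real x else kern x t)"
  have k: "(\<lambda>w. k (c * w)) has_fps_expansion (Abs_fps (kern_coeff x) oo (fps_const c * fps_X))" for c
    unfolding k_def
    by (rule has_fps_expansion_compose[OF kern_has_fps_expansion, unfolded o_def])
       (auto intro!: fps_expansion_intros)
  define F where "F = (Abs_fps (kern_coeff x) oo (fps_const d * fps_X)) *
                        (Abs_fps (kern_coeff x) oo (fps_const c * fps_X))"
  have F: "(\<lambda>w. k (d * w) * k (c * w)) has_fps_expansion F"
    unfolding F_def by (intro fps_expansion_intros k)
  have ev: "eventually (\<lambda>w. w \<noteq> 0) (at (0::complex))" by (simp add: eventually_at_filter)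
  show ?thesis
  proof (cases "a \<ge> 1")
    case False
    have "(\<lambda>w. k (d * w) * k (c * w)) analytic_on {0}"
      using F by (rule has_fps_expansion_imp_analytic_0)
    then obtain s where s: "open s" "0 \<in> s" "(\<lambda>w. k (d * w) * k (c * w)) holomorphic_on s"
      by (auto simp: analytic_at)
    have "residue (\<lambda>w. w powi (1 - 2 * a) * (kern x (c * w) * kern x (d * w))) 0 =
          residue (\<lambda>w. w ^ nat (1 - 2 * a) * (k (d * w) * k (c * w))) 0"
      by (rule residue_cong, rule eventually_mono[OF ev]) (use assms False in \<open>auto simp: k_def power_int_def\<close>)
    also have "\<dots> = 0"
      by (rule residue_holo[of s]) (use s in \<open>auto intro!: holomorphic_intros\<close>)
    finally show ?thesis using False by simp
  next
    case True
    \<comment> \<open>The pole has order 2m + 1, so the coefficient sought has the even degree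
      2m.\<close>
    define m where "m = nat a - 1"
    have a: "nat a = Suc m" "a = int (Suc m)" using True by (auto simp: m_def)
    have p: "w powi (1 - 2 * a) = 1 / (w * w ^ (2 * m))" for w :: complex
    proof -
      have "1 - 2 * a = - int (Suc (2 * m))" using a by simp
      thus ?thesis by (simp only: power_int_minus power_int_of_nat) (simp add: field_simps)
    qed
    have "residue (\<lambda>w. w powi (1 - 2 * a) * (kern x (c * w) * kern x (d * w))) 0 =
          residue (\<lambda>w. (k (d * w) * k (c * w)) / w ^ Suc (2 * m)) 0"
      unfolding p
      by (rule residue_cong, rule eventually_mono[OF ev]) (use assms in \<open>auto simp: k_def field_simps\<close>)
    also have "\<dots> = fps_nth F (2 * m)"
      by (rule residue_fps_expansion_over_power_at_0) (rule F)
    also have "\<dots> = (\<Sum>i=0..2*m. (d ^ i * kern_coeff x i) * (c ^ (2 * m - i) * kern_coeff x (2 * m - i)))"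
      by (simp add: F_def fps_mult_nth)
    \<comment> \<open>Odd indices contribute 0; for even i the complementary index 2m - i is even
      too.\<close>
    also have "\<dots> = (\<Sum>i\<in>(\<lambda>n. 2 * n) ` {..<Suc m}. (d ^ i * kern_coeff x i) * (c ^ (2 * m - i) * kern_coeff x (2 * m - i)))"
    proof (rule sum.mono_neutral_right)
      show "\<forall>i\<in>{0..2 * m} - (*) 2 ` {..<Suc m}. d ^ i * kern_coeff x i * (c ^ (2 * m - i) * kern_coeff x (2 * m - i)) = 0"
      proof
        fix i assume i: "i \<in> {0..2 * m} - (*) 2 ` {..<Suc m}"
        have "odd i"
        proof
          assume "even i"
          then obtain j where "i = 2 * j" by blast
          thus False using i by auto
        qed
        thus "d ^ i * kern_coeff x i * (c ^ (2 * m - i) * kern_coeff x (2 * m - i)) = 0"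
          by (simp add: kern_coeff_def)
      qed
    qed auto
    also have "\<dots> = (\<Sum>n<Suc m. (d ^ (2*n) * kern_coeff x (2*n)) * (c ^ (2 * m - 2*n) * kern_coeff x (2 * m - 2*n)))"
      by (subst sum.reindex) (auto simp: inj_on_def)
    also have "\<dots> = (\<Sum>n<Suc m. 4 * (of_real (bernpoly (2 * n + 1) x * bernpoly (2 * Suc m - 1 - 2 * n) x)
                       / (fact (2 * n + 1) * fact (2 * Suc m - 1 - 2 * n)) *
                       d ^ (2 * n) * c ^ (2 * (Suc m - 1 - n))))"
    proof (rule sum.cong)
      fix n assume n: "n \<in> {..<Suc m}"
      have "2 * Suc m - 1 - 2 * n = Suc (2 * m - 2 * n)" "2 * (Suc m - 1 - n) = 2 * m - 2 * n"
        using n by auto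
      thus "(d ^ (2*n) * kern_coeff x (2*n)) * (c ^ (2 * m - 2*n) * kern_coeff x (2 * m - 2*n)) =
        4 * (of_real (bernpoly (2 * n + 1) x * bernpoly (2 * Suc m - 1 - 2 * n) x)
                       / (fact (2 * n + 1) * fact (2 * Suc m - 1 - 2 * n)) *
                       d ^ (2 * n) * c ^ (2 * (Suc m - 1 - n)))"
        by (simp only:) (simp add: kern_coeff_def del: fact_Suc)
    qed auto
    finally show ?thesis by (simp only: a nat_int sum_distrib_left)
  qed
qed

section \<open>Evenness, bounds and simple poles of the kernel\<close>

lemma kern_minus: "kern x (-t) = kern x t"
proof (cases "exp t = 1")
  case True
  thus ?thesis by (simp add: kern_def exp_minus)
next
  case False
  have "exp ((1 - of_real x) * (-t)) = exp (of_real x * t) / exp t"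
       "exp (of_real x * (-t)) = exp ((1 - of_real x) * t) / exp t"
    by (simp_all add: algebra_simps flip: exp_diff)
  thus ?thesis using False by (simp add: kern_def exp_minus divide_simps) (simp add: algebra_simps)
qed

lemma kern_holomorphic:
  assumes "\<And>w. w \<in> A \<Longrightarrow> exp (c * w) \<noteq> 1"
  shows "(\<lambda>w. kern x (c * w)) holomorphic_on A"
  unfolding kern_def by (intro holomorphic_intros) (use assms in auto)

text \<open>For 0 < y < 1 the value exp (y Re t) lies between 1 and exp (Re t). Bounding it by their
  sum matches the size 1 + exp (Re t) of the denominator on the lines where e^t is negative.\<close>

lemma norm_kern_numer:
  assumes "0 < x" "x < 1"
  shows "norm (exp ((1 - of_real x) * t) - exp (of_real x * t)) \<le> 2 * (1 + exp (Re t))"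
proof -
  have *: "norm (exp (of_real y * t)) \<le> 1 + exp (Re t)" if "0 < y" "y < 1" for y
  proof -
    have "y * Re t \<le> max 0 (Re t)" using that
      by (cases "Re t \<ge> 0") (auto simp: max_def mult_left_le_one_le mult_pos_neg intro: less_imp_le)
    hence "exp (y * Re t) \<le> exp (max 0 (Re t))" by simp
    also have "\<dots> \<le> 1 + exp (Re t)" by (auto simp: max_def)
    finally show ?thesis by simp
  qed
  have "norm (exp (of_real (1 - x) * t) - exp (of_real x * t)) \<le> (1 + exp (Re t)) + (1 + exp (Re t))"
    by (rule order.trans[OF norm_triangle_ineq4], rule add_mono) (use assms in \<open>intro *; simp\<close>)+
  thus ?thesis by simp
qed

text \<open>On the lines Im t = \<pi> mod 2\<pi> there is no cancellation in e^t - 1, whose modulus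
  is exactly 1 + exp (Re t). The vertical sides of the contour lead to such t.\<close>

lemma norm_kern_neg_real:
  assumes "0 < x" "x < 1" "exp t = - of_real (exp (Re t))"
  shows "norm (kern x t) \<le> 2"
proof -
  have "exp t - 1 = - of_real (exp (Re t) + 1)" using assms(3) by simp
  hence "norm (exp t - 1) = 1 + exp (Re t)"
    by (simp only: norm_minus_cancel norm_of_real) (simp add: add_pos_pos)
  thus ?thesis using norm_kern_numer[OF assms(1,2), of t]
    by (simp add: kern_def norm_divide divide_simps add_pos_pos)
qed

text \<open>For Re t \<ge> 1 both exponentials in the numerator are at most exp ((1-\<delta>) Re t)
  with \<delta> = min x (1-x), while the denominator is at least exp (Re t)/2 because exp (Re t)
  \<ge> 2. Evenness covers Re t \<le> -1.\<close>

lemma norm_kern_decay: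
  assumes "0 < x" "x < 1" "\<bar>Re t\<bar> \<ge> 1"
  shows "norm (kern x t) \<le> 4 * exp (- min x (1 - x) * \<bar>Re t\<bar>)"
proof -
  define \<delta> where "\<delta> = min x (1 - x)"
  have *: "norm (kern x t) \<le> 4 * exp (- \<delta> * Re t)" if t: "Re t \<ge> 1" for t
  proof -
    have le: "norm (exp (of_real y * t)) \<le> exp ((1 - \<delta>) * Re t)" if "y \<le> 1 - \<delta>" for y
      using that t by (simp add: mult_right_mono)
    have "norm (exp (of_real (1 - x) * t) - exp (of_real x * t)) \<le>
            exp ((1 - \<delta>) * Re t) + exp ((1 - \<delta>) * Re t)"
      by (rule order.trans[OF norm_triangle_ineq4], rule add_mono; rule le) (simp_all add: \<delta>_def)
    hence "norm (exp ((1 - of_real x) * t) - exp (of_real x * t)) \<le> 2 * exp ((1 - \<delta>) * Re t)"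
      by simp
    moreover have "norm (exp t - 1) \<ge> exp (Re t) / 2"
    proof -
      have "norm (exp t - 1) \<ge> exp (Re t) - 1"
        using norm_triangle_ineq2[of "exp t" 1] by simp
      moreover have "exp (Re t) \<ge> 2"
        using exp_ge_add_one_self[of "Re t"] t by linarith
      ultimately show ?thesis by simp
    qed
    ultimately have "norm (kern x t) \<le> 2 * exp ((1 - \<delta>) * Re t) / (exp (Re t) / 2)"
      unfolding kern_def norm_divide by (intro frac_le) auto
    also have "\<dots> = 4 * exp (- \<delta> * Re t)"
      by (simp add: algebra_simps exp_diff exp_minus field_simps)
    finally show ?thesis .
  qed
  show ?thesis
    using *[of t] *[of "-t"] assms(3) by (cases "Re t \<ge> 0") (auto simp: kern_minus \<delta>_def)
qed

lemma one_plus_exp_neq_0: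
  assumes "Im \<tau> > 0"
  shows "1 + exp (2 * of_real pi * \<i> * \<tau> * of_real r) \<noteq> 0"
proof
  assume "1 + exp (2 * of_real pi * \<i> * \<tau> * of_real r) = 0"
  hence e: "exp (2 * of_real pi * \<i> * \<tau> * of_real r) = -1"
    by (simp add: add_eq_0_iff)
  hence "norm (exp (2 * of_real pi * \<i> * \<tau> * of_real r)) = 1" by simp
  hence "r = 0" using assms by simp
  with e show False by simp
qed

text \<open>Serves the horizontal sides, where \<tau>w is a half-integer plus a real multiple r of
  \<tau>. Prescribing only \<open>exp t\<close> leaves t free up to multiples of 2\<pi>i, so one
  bound serves all contours. For \<bar>Re t\<bar> \<ge> 1 the decay estimate gives 4; otherwise r
  lies in the compact interval [-R, R], on which the denominator is bounded away from 0.\<close>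

lemma norm_kern_shifted_line:
  assumes x: "0 < x" "x < 1" and \<tau>: "Im \<tau> > 0"
  obtains B where "\<And>r t. exp t = - exp (2 * of_real pi * \<i> * \<tau> * of_real r) \<Longrightarrow> norm (kern x t) \<le> B"
proof -
  define R where "R = 1 / (2 * pi * Im \<tau>)"
  have R: "R > 0" using \<tau> by (simp add: R_def)
  have "continuous_on {-R..R} (\<lambda>r. 1 / (1 + exp (2 * of_real pi * \<i> * \<tau> * of_real r)))"
    by (intro continuous_intros) (use one_plus_exp_neq_0[OF \<tau>] in auto)
  hence "bounded ((\<lambda>r. 1 / (1 + exp (2 * of_real pi * \<i> * \<tau> * of_real r))) ` {-R..R})"
    by (intro compact_imp_bounded compact_continuous_image) auto
  then obtain C where C: "C > 0" "\<And>r. r \<in> {-R..R} \<Longrightarrow> norm (1 / (1 + exp (2 * of_real pi * \<i> * \<tau> * of_real r))) \<le> C"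
    unfolding bounded_pos by auto
  show ?thesis
  proof (rule that)
    fix r t assume t: "exp t = - exp (2 * of_real pi * \<i> * \<tau> * of_real r)"
    have "norm (exp t) = norm (exp (2 * of_real pi * \<i> * \<tau> * of_real r))" using t by simp
    hence Re: "Re t = - 2 * pi * Im \<tau> * r" by (simp only: norm_exp_eq_Re) simp
    show "norm (kern x t) \<le> 4 + 2 * (1 + exp 1) * C"
    proof (cases "\<bar>Re t\<bar> \<ge> 1")
      case True
      have "norm (kern x t) \<le> 4 * exp (- min x (1 - x) * \<bar>Re t\<bar>)"
        by (rule norm_kern_decay) (use x True in auto)
      also have "\<dots> \<le> 4 * 1" using x by (intro mult_left_mono) auto
      finally show ?thesis using C(1) by (simp add: add_pos_pos add_increasing2)
    next
      case False
      hence "\<bar>r\<bar> \<le> R" using \<tau> unfolding Re R_def by (simp add: abs_mult field_simps)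
      hence "norm (1 / (1 + exp (2 * of_real pi * \<i> * \<tau> * of_real r))) \<le> C" by (intro C(2)) auto
      moreover have "exp t - 1 = - (1 + exp (2 * of_real pi * \<i> * \<tau> * of_real r))" by (simp add: t)
      hence "norm (exp t - 1) = norm (1 + exp (2 * of_real pi * \<i> * \<tau> * of_real r))"
        by (simp only: norm_minus_cancel)
      ultimately have "norm (1 / (exp t - 1)) \<le> C" by (simp add: norm_divide)
      moreover have "exp (Re t) \<le> exp 1" using False by simp
      hence "norm (exp ((1 - of_real x) * t) - exp (of_real x * t)) \<le> 2 * (1 + exp 1)"
        by (intro order.trans[OF norm_kern_numer[OF x]]) simp
      ultimately have "norm (exp ((1 - of_real x) * t) - exp (of_real x * t)) * norm (1 / (exp t - 1)) \<le> 2 * (1 + exp 1) * C"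
        by (intro mult_mono) (auto intro: add_nonneg_nonneg)
      thus ?thesis by (simp add: kern_def norm_divide)
    qed
  qed
qed

text \<open>The denominator e^(cw) - 1 has a simple zero at p with derivative c, and e^(cp) = 1
  turns the exponent 1 - x of the numerator into -x. The factor \<open>H\<close> collects the rest
  of the integrand.\<close>

lemma residue_times_kern:
  assumes c: "c \<noteq> 0" and p: "exp (c * p) = 1" and H: "open S" "p \<in> S" "H holomorphic_on S"
  shows "residue (\<lambda>w. H w * kern x (c * w)) p = H p * (exp (- of_real x * (c * p)) - exp (of_real x * (c * p))) / c"
proof -
  have "((\<lambda>w. exp (c * w)) has_field_derivative c) (at p)"
    by (auto intro!: derivative_eq_intros simp: p)
  hence lim: "((\<lambda>w. (exp (c * w) - 1) / (w - p)) \<longlongrightarrow> c) (at p)"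
    by (simp add: has_field_derivative_iff p)
  \<comment> \<open>The quotient has a nonzero limit, so p is an isolated zero of the denominator; e
    is the radius of a disc without other zeros.\<close>
  have "eventually (\<lambda>w. (exp (c * w) - 1) / (w - p) \<noteq> 0) (at p)"
    using tendsto_imp_eventually_ne[OF lim] c by blast
  then obtain e where e: "e > 0" "\<And>w. w \<noteq> p \<Longrightarrow> dist w p < e \<Longrightarrow> exp (c * w) \<noteq> 1"
    unfolding eventually_at by auto
  define N where "N = (\<lambda>w. H w * (exp ((1 - of_real x) * (c * w)) - exp (of_real x * (c * w))))"
  have N: "N holomorphic_on S" unfolding N_def by (intro holomorphic_intros H)
  have "residue (\<lambda>w. H w * kern x (c * w)) p = N p / c"
  proof (rule residue_simple'[where s = "S \<inter> ball p e"])
    show "(\<lambda>w. H w * kern x (c * w)) holomorphic_on S \<inter> ball p e - {p}"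
      by (intro holomorphic_intros kern_holomorphic holomorphic_on_subset[OF H(3)])
         (use e in \<open>auto simp: dist_commute\<close>)
    have "isCont N p" using N H by (meson continuous_on_eq_continuous_at holomorphic_on_imp_continuous_on)
    hence "((\<lambda>w. N w / ((exp (c * w) - 1) / (w - p))) \<longlongrightarrow> N p / c) (at p)"
      by (intro tendsto_divide lim c) (simp add: isCont_def)
    thus "((\<lambda>w. H w * kern x (c * w) * (w - p)) \<longlongrightarrow> N p / c) (at p)"
      by (simp add: N_def kern_def)
  qed (use H e in auto)
  moreover have "exp ((1 - of_real x) * (c * p)) = exp (- of_real x * (c * p))"
    using p by (simp add: algebra_simps exp_diff exp_minus divide_inverse)
  ultimately show ?thesis by (simp add: N_def)
qed

subsection \<open>The series\<close>

text \<open>Ratio test: consecutive terms have quotient (1 + 1/n)^k r, which tends to r and is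
  eventually below the midpoint of r and 1.\<close>

lemma summable_power_times_geometric:
  fixes r :: real
  assumes "0 < r" "r < 1"
  shows "summable (\<lambda>n. real n ^ k * r ^ n)"
proof -
  have "(\<lambda>n. (1 + 1 / real n) ^ k * r) \<longlonglongrightarrow> (1 + 0) ^ k * r"
    by (intro tendsto_intros lim_1_over_n)
  hence "eventually (\<lambda>n. (1 + 1 / real n) ^ k * r < (1 + r) / 2) sequentially"
    by (rule order_tendstoD) (use assms in auto)
  then obtain N where N: "\<And>n. n \<ge> N \<Longrightarrow> (1 + 1 / real n) ^ k * r < (1 + r) / 2"
    by (auto simp: eventually_sequentially)
  show ?thesis
  proof (rule summable_ratio_test)
    show "(1 + r) / 2 < 1" using assms by simp
    fix n assume n: "n \<ge> max N 1"
    have "real (Suc n) ^ k * r ^ Suc n = ((1 + 1 / real n) ^ k * r) * (real n ^ k * r ^ n)"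
    proof -
      have "real (Suc n) = (1 + 1 / real n) * real n" using n by (simp add: field_simps)
      thus ?thesis by (simp only: power_mult_distrib) simp
    qed
    also have "\<dots> \<le> (1 + r) / 2 * (real n ^ k * r ^ n)"
      using N[of n] n assms by (intro mult_right_mono) auto
    finally show "norm (real (Suc n) ^ k * r ^ Suc n) \<le> (1 + r) / 2 * norm (real n ^ k * r ^ n)"
      using assms by simp
  qed
qed

lemma inverse_power_int_le:
  assumes "n \<ge> 1"
  shows "1 / real n powi p \<le> real n ^ nat (-p)"
  using assms by (auto simp: power_int_def field_simps one_le_power)

text \<open>The strip means \<bar>q\<bar> < \<bar>\<zeta>\<bar> < 1, and each inequality handles one
  half of the index set. Terms with n > 0 are dominated by \<bar>\<zeta>\<bar>^n; for index -n the
  growth of q^(-n) in the denominator turns \<zeta>^(-n) into (q/\<zeta>)^n. The power of n costs at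
  most a polynomial factor.\<close>

lemma calE_summable:
  assumes "0 < Im z" "Im z < Im \<tau>"
  defines "q \<equiv> exp (2 * of_real pi * \<i> * \<tau>)" and "\<zeta> \<equiv> exp (2 * of_real pi * \<i> * z)"
  shows "(\<lambda>n. \<zeta> powi n / (of_int n powi p * (1 - q powi n))) summable_on UNIV - {0::int}"
proof -
  let ?f = "\<lambda>n. \<zeta> powi n / (of_int n powi p * (1 - q powi n))"
  define k where "k = nat (-p)"
  have norms: "norm \<zeta> < 1" "norm q < norm \<zeta>" "norm q > 0" "norm \<zeta> > 0" "norm q < 1"
    using assms by (auto simp: q_def \<zeta>_def)
  have q1: "norm (1 - q ^ n) \<ge> 1 - norm q" if "n \<ge> 1" for n
  proof -
    have "norm (1 - q ^ n) \<ge> 1 - norm q ^ n"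
      using norm_triangle_ineq2[of 1 "q ^ n"] by (simp add: norm_power)
    moreover have "norm q ^ n \<le> norm q ^ 1" using that norms by (intro power_decreasing) auto
    ultimately show ?thesis by simp
  qed
  have 1: "norm (?f (int n)) \<le> real n ^ k * norm \<zeta> ^ n * (1 / (1 - norm q))" if "n \<ge> 1" for n
  proof -
    have "norm (?f (int n)) = (1 / real n powi p) * norm \<zeta> ^ n * (1 / norm (1 - q ^ n))"
      by (simp add: norm_divide norm_mult norm_power_int norm_power)
    also have "\<dots> \<le> real n ^ k * norm \<zeta> ^ n * (1 / (1 - norm q))"
      using that norms q1[OF that] unfolding k_def
      by (intro mult_mono inverse_power_int_le divide_left_mono mult_pos_pos) auto
    finally show ?thesis .
  qed
  have 2: "norm (?f (- int n)) \<le> real n ^ k * (norm q / norm \<zeta>) ^ n * (1 / (1 - norm q))" if "n \<ge> 1" for n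
  proof -
    have "q ^ n * (1 - q powi (- int n)) = q ^ n - 1"
      using norms by (auto simp: power_int_minus algebra_simps)
    hence "norm q ^ n * norm (1 - q powi (- int n)) = norm (1 - q ^ n)"
      by (metis norm_minus_commute norm_mult norm_power)
    hence A: "norm (1 - q powi (- int n)) = norm (1 - q ^ n) / norm q ^ n"
      using norms by (simp add: field_simps)
    have "norm (?f (- int n)) =
        norm \<zeta> powi (- int n) / (norm (of_int (- int n) :: complex) powi p * norm (1 - q powi (- int n)))"
      by (simp only: norm_divide norm_mult norm_power_int)
    also have "\<dots> = (1 / norm \<zeta> ^ n) / (real n powi p * (norm (1 - q ^ n) / norm q ^ n))"
      unfolding A by (simp add: power_int_minus divide_inverse)
    also have "\<dots> = (1 / real n powi p) * (norm q / norm \<zeta>) ^ n * (1 / norm (1 - q ^ n))"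
      by (simp add: power_divide)
    also have "\<dots> \<le> real n ^ k * (norm q / norm \<zeta>) ^ n * (1 / (1 - norm q))"
      using that norms q1[OF that] unfolding k_def
      by (intro mult_mono inverse_power_int_le divide_left_mono mult_pos_pos) auto
    finally show ?thesis .
  qed
  have bound_imp: "(\<lambda>n::nat. g n) summable_on {1..}"
    if "0 < r" "r < 1" "\<And>n. n \<ge> 1 \<Longrightarrow> norm (g n) \<le> real n ^ k * r ^ n * C" for g :: "nat \<Rightarrow> complex" and r C
  proof -
    have "summable (\<lambda>n. norm (g n))"
    proof (rule summable_comparison_test')
      show "summable (\<lambda>n. real n ^ k * r ^ n * C)"
        by (intro summable_mult2 summable_power_times_geometric that)
      show "norm (norm (g n)) \<le> real n ^ k * r ^ n * C" if "n \<ge> 1" for n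
        using that \<open>\<And>n. n \<ge> 1 \<Longrightarrow> norm (g n) \<le> real n ^ k * r ^ n * C\<close> by simp
    qed
    from norm_summable_imp_summable_on[OF this] show ?thesis
      by (rule summable_on_subset_banach) auto
  qed
  have "(?f \<circ> int) summable_on {1..}"
    unfolding o_def by (rule bound_imp[of "norm \<zeta>"]) (rule norms | erule 1)+
  hence "?f summable_on int ` {1..}"
    by (simp only: summable_on_reindex[OF inj_on_of_nat])
  moreover have "(?f \<circ> (\<lambda>n. - int n)) summable_on {1..}"
    unfolding o_def by (rule bound_imp[of "norm q / norm \<zeta>"]) (use norms in simp, use norms in simp, erule 2)
  hence "?f summable_on (\<lambda>n. - int n) ` {1..}"
    by (subst summable_on_reindex) (auto intro: inj_onI)
  ultimately have "?f summable_on (int ` {1..} \<union> (\<lambda>n. - int n) ` {1..})"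
    by (rule summable_on_Un_disjoint) auto
  also have "int ` {1..} \<union> (\<lambda>n. - int n) ` {1..} = UNIV - {0}"
  proof (intro equalityI subsetI)
    fix n :: int assume "n \<in> UNIV - {0}"
    hence "n = int (nat n) \<and> nat n \<ge> 1 \<or> n = - int (nat (-n)) \<and> nat (-n) \<ge> 1" by auto
    thus "n \<in> int ` {1..} \<union> (\<lambda>n. - int n) ` {1..}" by (metis UnI1 UnI2 atLeast_iff image_eqI)
  qed auto
  finally show ?thesis .
qed

text \<open>
  Combining the terms for \<open>\<epsilon> = 1\<close> and \<open>\<epsilon> = -1\<close>, whose arguments are \<open>(1 - x)(1 + \<tau>)\<close> and
  \<open>(1 - x) + x\<tau>\<close>, produces a single kernel value.
\<close>

definition calE_term :: "int \<Rightarrow> real \<Rightarrow> complex \<Rightarrow> int \<Rightarrow> complex" where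
  "calE_term a x \<tau> n =
     - exp (- of_real x * (2 * of_real pi * \<i> * of_int n)) * kern x (2 * of_real pi * \<i> * \<tau> * of_int n) *
       of_int n powi (1 - 2 * a)"

text \<open>The two arguments have imaginary parts (1-x) Im \<tau> and x Im \<tau>, both inside the
  strip of convergence, so the two series can be subtracted termwise.\<close>

lemma calE_term_has_sum:
  assumes "0 < x" "x < 1" "Im \<tau> > 0"
  shows "(calE_term a x \<tau> has_sum
           (\<Sum>\<epsilon>\<in>{1, -1 :: complex}.
              \<epsilon> * calE (2 - 2 * a) (((1 - 2 * of_real x) * (1 + \<epsilon> * \<tau>) + \<tau> + 1) / 2) \<tau>))
         (UNIV - {0})"
proof -
  define q where "q = exp (2 * of_real pi * \<i> * \<tau>)"
  define z where "z = (\<lambda>\<epsilon>. ((1 - 2 * of_real x) * (1 + \<epsilon> * \<tau>) + \<tau> + 1) / 2)"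
  define f where "f = (\<lambda>\<epsilon> n. exp (2 * of_real pi * \<i> * z \<epsilon>) powi n / (of_int n powi (2 * a - 1) * (1 - q powi n)))"
  have z: "z 1 = (1 - of_real x) * (1 + \<tau>)" "z (-1) = (1 - of_real x) + of_real x * \<tau>"
    by (simp_all add: z_def field_simps)
  have "(f \<epsilon> has_sum calE (2 - 2 * a) (z \<epsilon>) \<tau>) (UNIV - {0})" if "0 < Im (z \<epsilon>)" "Im (z \<epsilon>) < Im \<tau>" for \<epsilon>
    using has_sum_infsum[OF calE_summable[OF that, of "2 * a - 1"]]
    by (simp add: calE_def Let_def f_def q_def)
  moreover have "0 < Im (z 1)" "Im (z 1) < Im \<tau>" "0 < Im (z (-1))" "Im (z (-1)) < Im \<tau>"
    using assms by (simp_all add: z)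
  ultimately have "(f 1 has_sum calE (2 - 2 * a) (z 1) \<tau>) (UNIV - {0})"
        "(f (-1) has_sum calE (2 - 2 * a) (z (-1)) \<tau>) (UNIV - {0})"
    by blast+
  hence "((\<lambda>n. f 1 n - f (-1) n) has_sum (calE (2 - 2 * a) (z 1) \<tau> - calE (2 - 2 * a) (z (-1)) \<tau>)) (UNIV - {0})"
    unfolding diff_conv_add_uminus by (intro has_sum_add) (simp_all add: has_sum_uminus)
  also have "calE (2 - 2 * a) (z 1) \<tau> - calE (2 - 2 * a) (z (-1)) \<tau> = 
               (\<Sum>\<epsilon>\<in>{1, -1 :: complex}. \<epsilon> * calE (2 - 2 * a) (z \<epsilon>) \<tau>)"
    by simp
  finally have "((\<lambda>n. f 1 n - f (-1) n) has_sum (\<Sum>\<epsilon>\<in>{1, -1 :: complex}. \<epsilon> * calE (2 - 2 * a) (z \<epsilon>) \<tau>)) (UNIV - {0})" .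
  also have "?this \<longleftrightarrow> (calE_term a x \<tau> has_sum (\<Sum>\<epsilon>\<in>{1, -1 :: complex}. \<epsilon> * calE (2 - 2 * a) (z \<epsilon>) \<tau>)) (UNIV - {0})"
  proof (rule has_sum_cong)
    fix n :: int
    define T where "T = 2 * of_real pi * \<i> * \<tau> * of_int n"
    define X where "X = 2 * of_real pi * \<i> * of_int n"
    have qn: "q powi n = exp T"
      unfolding q_def T_def by (simp add: exp_power_int mult_ac)
    have X: "exp X = 1" unfolding X_def using exp_integer_2pi[of "of_int n"] by (simp add: mult_ac)
    have "(exp (2 * of_real pi * \<i> * z 1)) powi n = exp ((1 - of_real x) * X + (1 - of_real x) * T)"
      unfolding z T_def X_def by (simp add: exp_power_int algebra_simps)
    moreover have "(exp (2 * of_real pi * \<i> * z (-1))) powi n = exp ((1 - of_real x) * X + of_real x * T)"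
      unfolding z T_def X_def by (simp add: exp_power_int algebra_simps)
    \<comment> \<open>Both terms share this factor; what remains is the numerator of the kernel at
      \<open>T\<close>, over 1 - e^T instead of e^T - 1, whence the sign in
      \<open>calE_term\<close>.\<close>
    moreover have "exp ((1 - of_real x) * X) = exp (- of_real x * X)"
      using X by (simp add: algebra_simps exp_diff exp_minus divide_inverse)
    ultimately have "f 1 n - f (-1) n =
        (exp (- of_real x * X) * exp ((1 - of_real x) * T) - exp (- of_real x * X) * exp (of_real x * T)) /
        (of_int n powi (2 * a - 1) * (1 - exp T))"
      by (simp only: f_def qn exp_add diff_divide_distrib)
    also have "\<dots> = exp (- of_real x * X) *
        ((exp ((1 - of_real x) * T) - exp (of_real x * T)) / (1 - exp T)) / of_int n powi (2 * a - 1)"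
      by (simp only: right_diff_distrib[symmetric]) (simp add: mult.commute)
    also have "(exp ((1 - of_real x) * T) - exp (of_real x * T)) / (1 - exp T) = - kern x T"
      unfolding kern_def by (metis minus_diff_eq minus_divide_right)
    also have "exp (- of_real x * X) * - kern x T / of_int n powi (2 * a - 1) =
                 - exp (- of_real x * X) * kern x T * of_int n powi (- (2 * a - 1))"
      by (simp only: power_int_minus) (simp add: field_simps)
    finally show "f 1 n - f (-1) n = calE_term a x \<tau> n"
      by (simp add: calE_term_def T_def X_def)
  qed
  finally show ?thesis unfolding z_def .
qed

text \<open>Unconditional convergence allows any sequence of finite sets that eventually contains
  each given one. The free \<open>L\<close> is for the real poles, whose number inside the contour
  grows faster than its index.\<close>

lemma has_sum_imp_symmetric_partial_sums:
  fixes f :: "int \<Rightarrow> 'a :: {comm_monoid_add, topological_space}"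
  assumes "(f has_sum s) (UNIV - {0})" "filterlim L at_top at_top"
  shows "(\<lambda>N :: nat. \<Sum>n\<in>{-int (L N)..int (L N)} - {0}. f n) \<longlonglongrightarrow> s"
proof -
  have "filterlim (\<lambda>N. {-int (L N)..int (L N)} - {0}) (finite_subsets_at_top (UNIV - {0})) sequentially"
    unfolding filterlim_finite_subsets_at_top
  proof (intro allI impI)
    fix X :: "int set" assume X: "finite X \<and> X \<subseteq> UNIV - {0}"
    define B where "B = nat (Max (insert 0 (abs ` X)))"
    have B: "\<bar>n\<bar> \<le> int B" if "n \<in> X" for n
    proof -
      have "\<bar>n\<bar> \<le> Max (insert 0 (abs ` X))" using X that by (intro Max_ge) auto
      moreover have "Max (insert 0 (abs ` X)) \<ge> 0" using X by (intro Max_ge) auto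
      ultimately show ?thesis by (simp add: B_def)
    qed
    from assms(2) have "eventually (\<lambda>N. L N \<ge> B) sequentially"
      by (simp add: filterlim_at_top)
    thus "\<forall>\<^sub>F N in sequentially. finite ({-int (L N)..int (L N)} - {0}) \<and> X \<subseteq> {-int (L N)..int (L N)} - {0} \<and>
            {-int (L N)..int (L N)} - {0} \<subseteq> UNIV - {0}"
    proof eventually_elim
      case (elim N)
      have "n \<in> {-int (L N)..int (L N)} - {0}" if "n \<in> X" for n
        using B[OF that] elim X that by auto
      thus ?case by auto
    qed
  qed
  thus ?thesis using assms(1) unfolding has_sum_def by (rule filterlim_compose[rotated])
qed

subsection \<open>The contour integral\<close>

lemma exp_2pi_i_eq_1_iff: "exp (2 * of_real pi * \<i> * w) = 1 \<longleftrightarrow> (\<exists>n::int. w = of_int n)"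
proof
  assume "exp (2 * of_real pi * \<i> * w) = 1"
  then obtain n :: int where "Im w = 0" "2 * pi * Re w = of_int (2 * n) * pi"
    by (auto simp: exp_eq_1)
  hence "w = of_int n" by (simp add: complex_eq_iff)
  thus "\<exists>n::int. w = of_int n" ..
next
  assume "\<exists>n::int. w = of_int n"
  thus "exp (2 * of_real pi * \<i> * w) = 1" by (auto simp: exp_eq_1)
qed

lemma exp_2pi_i_half_integer:
  assumes "\<bar>m\<bar> = real n + 1 / 2"
  shows "exp (2 * of_real pi * \<i> * (of_real m + w)) = - exp (2 * of_real pi * \<i> * w)"
proof -
  have "m - 1 / 2 = of_int (int n) \<or> m - 1 / 2 = of_int (- int n - 1)"
    using assms by (auto simp: abs_if split: if_splits)
  then obtain j :: int where j: "m = of_int j + 1 / 2" by (metis diff_add_cancel)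
  have "2 * of_real pi * \<i> * (of_real m + w) =
          2 * of_real pi * \<i> * of_int j + (of_real pi * \<i> + 2 * of_real pi * \<i> * w)"
    by (simp add: j algebra_simps)
  moreover have "exp (2 * of_real pi * \<i> * of_int j) = 1"
    unfolding exp_2pi_i_eq_1_iff by blast
  ultimately show ?thesis by (simp only: exp_add exp_pi_i) simp
qed

text \<open>Each of the four sides is no longer than the diagonal.\<close>

lemma norm_contour_integral_rectpath_le:
  assumes cont: "continuous_on (path_image (rectpath a b)) f"
    and bound: "\<And>z. z \<in> path_image (rectpath a b) \<Longrightarrow> norm (f z) \<le> B" and "B \<ge> 0"
  shows "norm (contour_integral (rectpath a b) f) \<le> 4 * B * norm (b - a)"
proof -
  define c d where "c = Complex (Re b) (Im a)" and "d = Complex (Re a) (Im b)"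
  have path: "rectpath a b = linepath a c +++ linepath c b +++ linepath b d +++ linepath d a"
    by (simp add: rectpath_def c_def d_def Let_def)
  have img: "path_image (rectpath a b) =
      closed_segment a c \<union> closed_segment c b \<union> closed_segment b d \<union> closed_segment d a"
    by (simp add: path path_image_join Un_assoc)
  have hc: "(f has_contour_integral contour_integral (linepath u v) f) (linepath u v)"
    and le: "norm (contour_integral (linepath u v) f) \<le> B * norm (v - u)"
    if "closed_segment u v \<subseteq> path_image (rectpath a b)" for u v
  proof -
    have "f contour_integrable_on linepath u v"
      by (rule contour_integrable_continuous_linepath) (rule continuous_on_subset[OF cont that])
    thus "(f has_contour_integral contour_integral (linepath u v) f) (linepath u v)"
      by (rule has_contour_integral_integral)
    thus "norm (contour_integral (linepath u v) f) \<le> B * norm (v - u)"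
      by (rule has_contour_integral_bound_linepath) (use assms that in auto)
  qed
  have len: "norm (c - a) \<le> norm (b - a)" "norm (b - c) \<le> norm (b - a)"
            "norm (d - b) \<le> norm (b - a)" "norm (a - d) \<le> norm (b - a)"
    using abs_Re_le_cmod[of "b - a"] abs_Im_le_cmod[of "b - a"]
    by (auto simp: c_def d_def cmod_def abs_minus_commute)
  have "contour_integral (rectpath a b) f =
          contour_integral (linepath a c) f + (contour_integral (linepath c b) f +
          (contour_integral (linepath b d) f + contour_integral (linepath d a) f))"
    unfolding path
    by (intro contour_integral_unique has_contour_integral_join hc) (auto simp: img)
  also have "norm \<dots> \<le> B * norm (b - a) + (B * norm (b - a) + (B * norm (b - a) + B * norm (b - a)))"
    by (intro order.trans[OF norm_triangle_ineq] add_mono order.trans[OF le] mult_left_mono len assms(3))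
       (auto simp: img)
  finally show ?thesis by simp
qed

text \<open>The kernel is even and the exponent 1 - 2a is odd, so the two exponentials combine into
  the difference that occurs in the residue.\<close>

lemma calE_term_reflect:
  assumes "n \<noteq> 0"
  shows "calE_term a x \<tau> n + calE_term a x \<tau> (-n) =
    - (exp (- of_real x * (2 * of_real pi * \<i> * of_int n)) - exp (of_real x * (2 * of_real pi * \<i> * of_int n))) *
       kern x (2 * of_real pi * \<i> * \<tau> * of_int n) * of_int n powi (1 - 2 * a)"
proof -
  have "(- of_int n :: complex) powi (1 - 2 * a) = - (of_int n powi (1 - 2 * a))"
    by (rule power_int_minus_left_odd) auto
  thus ?thesis by (simp add: calE_term_def kern_minus algebra_simps)
qed

lemma sum_reflect_symmetric:
  fixes f :: "int \<Rightarrow> 'a :: field"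
  shows "(\<Sum>n\<in>{-m..m} - {0}. f n + f (-n)) = 2 * (\<Sum>n\<in>{-m..m} - {0}. f n)"
proof -
  have "(\<Sum>n\<in>{-m..m} - {0}. f (-n)) = (\<Sum>n\<in>{-m..m} - {0}. f n)"
    by (rule sum.reindex_bij_witness[of _ uminus uminus]) auto
  thus ?thesis by (simp add: sum.distrib)
qed

lemma norm_power_int_le:
  assumes "norm (w :: complex) \<ge> 1"
  shows "norm (w powi p) \<le> norm w ^ nat \<bar>p\<bar>"
proof (cases "p \<ge> 0")
  case True
  thus ?thesis by (simp add: power_int_def norm_power)
next
  case False
  hence "norm (w powi p) = inverse (norm w ^ nat \<bar>p\<bar>)"
    by (simp add: power_int_def norm_power norm_inverse power_inverse)
  also have "\<dots> \<le> 1" using assms by (simp add: inverse_le_1_iff)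
  also have "1 \<le> norm w ^ nat \<bar>p\<bar>" using assms by simp
  finally show ?thesis .
qed

section \<open>Rectangles passing between the poles, and the integrand on them\<close>

locale kern_contour =
  fixes x :: real and \<tau> :: complex and a :: int
  assumes x: "0 < x" "x < 1" and \<tau>: "Im \<tau> > 0"
begin

definition integrand :: "complex \<Rightarrow> complex" where
  "integrand w = w powi (1 - 2 * a) * (kern x (2 * of_real pi * \<i> * w) * kern x (2 * of_real pi * \<i> * \<tau> * w))"

text \<open>
  The contour is the boundary of the rectangle with corners \<open>\<plusminus>M(K \<plusminus> \<i>h)\<close>, where \<open>M = N + 1/2\<close> and
  \<open>K = 2k + 1\<close>. The height \<open>h\<close> makes the horizontal sides meet the line through the poles \<open>m/\<tau>\<close> at
  \<open>\<plusminus>M/\<tau>\<close>, halfway between two poles. Choosing \<open>K > \<bar>Re (1/\<tau>)\<bar>\<close> keeps that line away from the vertical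
  sides, and \<open>K\<close> odd makes these meet the real axis at the half-integers \<open>\<plusminus>(L N + 1/2)\<close>.
\<close>

definition h :: real where "h = - Im (1 / \<tau>)"

definition k :: nat where "k = nat \<lceil>\<bar>Re (1 / \<tau>)\<bar>\<rceil>"

definition L :: "nat \<Rightarrow> nat" where "L N = k + N + 2 * k * N"

definition corner :: "nat \<Rightarrow> complex" where
  "corner N = Complex ((2 * real k + 1) * (real N + 1 / 2)) (h * (real N + 1 / 2))"

lemma \<tau>_nz: "\<tau> \<noteq> 0" using \<tau> by auto

lemma h_pos: "h > 0"
  using \<tau> by (auto simp: h_def Im_divide intro!: divide_pos_pos add_nonneg_pos)

lemma k_bound: "\<bar>Re (1 / \<tau>)\<bar> < 2 * real k + 1"
proof -
  have "\<bar>Re (1 / \<tau>)\<bar> \<le> real k" unfolding k_def by linarith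
  thus ?thesis by simp
qed

lemma L_half: "real (L N) + 1 / 2 = (2 * real k + 1) * (real N + 1 / 2)"
  by (simp add: L_def algebra_simps)

text \<open>Real coordinates along the two lines of poles. The first kernel factor decays with
  \<bar>Im w\<bar> = h\<bar>\<sigma>\<bar>; since \<tau>w = \<sigma> + \<tau>\<rho>, the second
  decays with \<bar>\<rho>\<bar>.\<close>

lemma lattice_coordinates:
  obtains \<rho> \<sigma> where "w = of_real \<rho> + of_real \<sigma> / \<tau>" "Im w = - h * \<sigma>" "Re w = \<rho> + \<sigma> * Re (1 / \<tau>)"
proof -
  define \<sigma> where "\<sigma> = - Im w / h"
  define \<rho> where "\<rho> = Re w - \<sigma> * Re (1 / \<tau>)"
  have 1: "Im w = - h * \<sigma>" "Re w = \<rho> + \<sigma> * Re (1 / \<tau>)"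
    using h_pos by (simp_all add: \<sigma>_def \<rho>_def)
  have "Im (of_real \<sigma> / \<tau>) = \<sigma> * Im (1 / \<tau>)" "Re (of_real \<sigma> / \<tau>) = \<sigma> * Re (1 / \<tau>)"
    by (simp_all add: Im_divide Re_divide)
  moreover have "Im (1 / \<tau>) = - h" by (simp add: h_def)
  ultimately have "w = of_real \<rho> + of_real \<sigma> / \<tau>" using 1 by (simp add: complex_eq_iff)
  thus ?thesis using 1 by (rule that)
qed

text \<open>The decay rate common to all sides: \<open>h\<close> comes from the horizontal sides,
  the last entry is the lower bound for \<bar>Im (\<tau>w)\<bar>/M on the vertical ones. The entry 1
  ensures M \<ge> 1 once \<mu>M \<ge> 1, which helps to keep \<bar>w\<bar> \<ge> 1.\<close>

definition \<mu> :: real where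
  "\<mu> = min 1 (min h (Im \<tau> * (2 * real k + 1 - \<bar>Re (1 / \<tau>)\<bar>)))"

lemma \<mu>_pos: "\<mu> > 0"
  using h_pos k_bound \<tau> by (simp add: \<mu>_def)

text \<open>On vertical sides the first kernel factor is at most 2 and the second decays; on
  horizontal sides the first decays and the second is at most \<open>B\<close>. The constant B + 2
  covers both cases.\<close>

lemma norm_integrand_boundary_le:
  obtains C where "C \<ge> 0"
    "\<And>N w. \<mu> * (real N + 1 / 2) \<ge> 1 \<Longrightarrow> w \<in> path_image (rectpath (- corner N) (corner N)) \<Longrightarrow>
       norm (integrand w) \<le> C * ((real N + 1 / 2) ^ nat \<bar>1 - 2 * a\<bar> *
                        exp (- (2 * pi * min x (1 - x) * \<mu>) * (real N + 1 / 2)))"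
proof -
  obtain B where B: "\<And>r t. exp t = - exp (2 * of_real pi * \<i> * \<tau> * of_real r) \<Longrightarrow> norm (kern x t) \<le> B"
    using norm_kern_shifted_line[OF x \<tau>] by blast
  have B0: "B \<ge> 0"
    using B[of "of_real pi * \<i>" 0] norm_ge_zero order.trans by (metis exp_pi_i exp_zero mult_zero_right of_real_0)
  define P where "P = nat \<bar>1 - 2 * a\<bar>"
  \<comment> \<open>On the contour \<bar>w\<bar> \<le> \<bar>Re w\<bar> + \<bar>Im w\<bar> \<le>
    QM.\<close>
  define Q where "Q = 2 * real k + 1 + h"
  show ?thesis
  proof (rule that)
    show "Q ^ P * (4 * (B + 2)) \<ge> 0" using h_pos B0 by (simp add: Q_def)
    fix N w
    assume large: "\<mu> * (real N + 1 / 2) \<ge> 1"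
      and w: "w \<in> path_image (rectpath (- corner N) (corner N))"
    define M where "M = real N + 1 / 2"
    have M: "M > 0" "\<mu> * M \<ge> 1" using large by (auto simp: M_def)
    define E where "E = exp (- (2 * pi * min x (1 - x) * \<mu>) * M)"
    have decay: "norm (kern x t) \<le> 4 * E" if "\<bar>Re t\<bar> \<ge> 2 * pi * (\<mu> * M)" for t
    proof -
      have "1 \<le> 2 * pi * (\<mu> * M)" using M(2) pi_ge_two mult_mono[of 1 "2 * pi" 1 "\<mu> * M"] by simp
      hence "norm (kern x t) \<le> 4 * exp (- min x (1 - x) * \<bar>Re t\<bar>)"
        using that by (intro norm_kern_decay x) auto
      also have "min x (1 - x) * \<bar>Re t\<bar> \<ge> min x (1 - x) * (2 * pi * (\<mu> * M))"
        using x that by (intro mult_left_mono) auto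
      hence "4 * exp (- min x (1 - x) * \<bar>Re t\<bar>) \<le> 4 * E"
        by (simp add: E_def mult_ac)
      finally show ?thesis .
    qed
    have "Re (- corner N) \<le> Re (corner N)" "Im (- corner N) \<le> Im (corner N)"
      using h_pos by (simp_all add: corner_def)
    from w[unfolded path_image_rectpath[OF this]]
    have sides: "\<bar>Re w\<bar> = (2 * real k + 1) * M \<and> \<bar>Im w\<bar> \<le> h * M \<or>
                 \<bar>Im w\<bar> = h * M \<and> \<bar>Re w\<bar> \<le> (2 * real k + 1) * M"
      using h_pos M by (auto simp: corner_def M_def abs_mult)
    obtain \<rho> \<sigma> where dec: "w = of_real \<rho> + of_real \<sigma> / \<tau>" "Im w = - h * \<sigma>" "Re w = \<rho> + \<sigma> * Re (1 / \<tau>)"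
      by (rule lattice_coordinates)
    have \<tau>w: "\<tau> * w = of_real \<sigma> + \<tau> * of_real \<rho>" using \<tau>_nz by (simp add: dec(1) algebra_simps)
    have kerns: "norm (kern x (2 * of_real pi * \<i> * w) * kern x (2 * of_real pi * \<i> * \<tau> * w)) \<le> (B + 2) * (4 * E)"
      using sides
    proof
      assume v: "\<bar>Re w\<bar> = (2 * real k + 1) * M \<and> \<bar>Im w\<bar> \<le> h * M"
      have "exp (2 * of_real pi * \<i> * (of_real (Re w) + \<i> * of_real (Im w))) =
              - exp (2 * of_real pi * \<i> * (\<i> * of_real (Im w)))"
        by (rule exp_2pi_i_half_integer[of _ "L N"]) (use v L_half[of N] in \<open>simp add: M_def\<close>)
      hence "exp (2 * of_real pi * \<i> * w) = - exp (of_real (- 2 * pi * Im w))"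
        by (simp add: complex_eq[symmetric] mult_ac)
      hence "exp (2 * of_real pi * \<i> * w) = - of_real (exp (Re (2 * of_real pi * \<i> * w)))"
        by (simp only: exp_of_real) simp
      hence 1: "norm (kern x (2 * of_real pi * \<i> * w)) \<le> 2" by (rule norm_kern_neg_real[OF x])
      have "\<bar>\<sigma>\<bar> \<le> M" using v h_pos by (simp add: dec(2) abs_mult)
      hence "\<bar>\<sigma> * Re (1 / \<tau>)\<bar> \<le> M * \<bar>Re (1 / \<tau>)\<bar>" unfolding abs_mult by (intro mult_right_mono) auto
      \<comment> \<open>The vertical side keeps a distance proportional to M from the line through
        the poles m/\<tau>, because 2k + 1 exceeds \<bar>Re (1/\<tau>)\<bar>.\<close>
      hence "\<bar>\<rho>\<bar> \<ge> (2 * real k + 1) * M - M * \<bar>Re (1 / \<tau>)\<bar>" using v dec(3) by linarith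
      hence "Im \<tau> * \<bar>\<rho>\<bar> \<ge> Im \<tau> * ((2 * real k + 1) * M - M * \<bar>Re (1 / \<tau>)\<bar>)"
        using \<tau> by (intro mult_left_mono) auto
      moreover have "\<mu> * M \<le> Im \<tau> * (2 * real k + 1 - \<bar>Re (1 / \<tau>)\<bar>) * M"
        using M by (intro mult_right_mono) (auto simp: \<mu>_def)
      ultimately have "\<mu> * M \<le> Im \<tau> * \<bar>\<rho>\<bar>" by (simp add: algebra_simps)
      moreover have "\<bar>Re (2 * of_real pi * \<i> * (\<tau> * w))\<bar> = 2 * pi * (Im \<tau> * \<bar>\<rho>\<bar>)"
        using \<tau> unfolding \<tau>w by (simp add: abs_mult)
      ultimately have "\<bar>Re (2 * of_real pi * \<i> * \<tau> * w)\<bar> \<ge> 2 * pi * (\<mu> * M)" by (simp add: mult.assoc)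
      from decay[OF this] 1 show ?thesis unfolding norm_mult using B0 by (intro mult_mono) auto
    next
      assume v: "\<bar>Im w\<bar> = h * M \<and> \<bar>Re w\<bar> \<le> (2 * real k + 1) * M"
      have "\<mu> * M \<le> h * M" using M by (intro mult_right_mono) (auto simp: \<mu>_def)
      hence "\<bar>Re (2 * of_real pi * \<i> * w)\<bar> \<ge> 2 * pi * (\<mu> * M)" using v by (simp add: abs_mult)
      note 1 = decay[OF this]
      have "\<bar>\<sigma>\<bar> = real N + 1 / 2" using v h_pos by (simp add: dec(2) abs_mult M_def)
      from exp_2pi_i_half_integer[OF this, of "\<tau> * of_real \<rho>"]
      have "exp (2 * of_real pi * \<i> * \<tau> * w) = - exp (2 * of_real pi * \<i> * \<tau> * of_real \<rho>)"
        by (simp add: \<tau>w mult.assoc)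
      from B[OF this] have "norm (kern x (2 * of_real pi * \<i> * \<tau> * w)) \<le> B + 2" by simp
      from mult_mono[OF this 1] B0 show ?thesis by (simp only: norm_mult mult.commute) simp
    qed
    \<comment> \<open>With \<bar>w\<bar> \<ge> 1 a single positive power of \<bar>w\<bar> bounds
      \<open>w powi (1 - 2 * a)\<close> for either sign of the exponent.\<close>
    have "norm w \<ge> 1"
    proof -
      have "\<mu> * M \<le> h * M" "\<mu> * M \<le> 1 * M" using M by (intro mult_right_mono; simp add: \<mu>_def)+
      moreover have "1 * M \<le> (2 * real k + 1) * M" using M by (intro mult_right_mono) auto
      ultimately show ?thesis using sides M abs_Re_le_cmod[of w] abs_Im_le_cmod[of w] by linarith
    qed
    hence "norm (w powi (1 - 2 * a)) \<le> norm w ^ P" unfolding P_def by (rule norm_power_int_le)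
    also have "norm w \<le> \<bar>Re w\<bar> + \<bar>Im w\<bar>" by (rule cmod_le)
    hence "norm w \<le> Q * M" using sides by (auto simp: Q_def algebra_simps)
    hence "norm w ^ P \<le> (Q * M) ^ P" by (rule power_mono) auto
    finally have "norm (integrand w) \<le> (Q * M) ^ P * ((B + 2) * (4 * E))"
      unfolding integrand_def norm_mult[of "w powi _"] using kerns M h_pos
      by (intro mult_mono) (auto simp: Q_def)
    thus "norm (integrand w) \<le> Q ^ P * (4 * (B + 2)) * ((real N + 1 / 2) ^ nat \<bar>1 - 2 * a\<bar> *
            exp (- (2 * pi * min x (1 - x) * \<mu>) * (real N + 1 / 2)))"
      by (simp only: P_def M_def E_def power_mult_distrib mult_ac)
  qed
qed

section \<open>Residues at the nonzero poles and the residue theorem\<close>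

lemma residue_int:
  assumes "n \<noteq> 0"
  shows "residue integrand (of_int n) =
           - (calE_term a x \<tau> n + calE_term a x \<tau> (-n)) / (2 * of_real pi * \<i>)"
proof -
  let ?S = "{w. exp (2 * of_real pi * \<i> * \<tau> * w) \<noteq> 1}"
  let ?H = "\<lambda>w. w powi (1 - 2 * a) * kern x (2 * of_real pi * \<i> * \<tau> * w)"
  have "open ?S" by (intro open_Collect_neq continuous_intros)
  moreover have "of_int n \<in> ?S"
  proof
    show "exp (2 * of_real pi * \<i> * \<tau> * of_int n) \<noteq> 1"
    proof
      assume "exp (2 * of_real pi * \<i> * \<tau> * of_int n) = 1"
      then obtain m :: int where "\<tau> * of_int n = of_int m"
        using exp_2pi_i_eq_1_iff[of "\<tau> * of_int n"] by (auto simp: mult.assoc)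
      hence "Im (\<tau> * of_int n) = 0" by simp
      thus False using \<tau> assms by simp
    qed
  qed
  moreover have "?H holomorphic_on ?S"
    by (intro holomorphic_intros kern_holomorphic) auto
  moreover have "exp (2 * of_real pi * \<i> * of_int n) = 1" by (auto simp: exp_2pi_i_eq_1_iff)
  ultimately have "residue (\<lambda>w. ?H w * kern x (2 * of_real pi * \<i> * w)) (of_int n) = ?H (of_int n) *
      (exp (- of_real x * (2 * of_real pi * \<i> * of_int n)) - exp (of_real x * (2 * of_real pi * \<i> * of_int n))) /
      (2 * of_real pi * \<i>)"
    by (intro residue_times_kern[where S = ?S]) simp_all
  moreover have "integrand = (\<lambda>w. ?H w * kern x (2 * of_real pi * \<i> * w))"
    by (simp add: integrand_def fun_eq_iff mult_ac)
  ultimately show ?thesis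
    unfolding calE_term_reflect[OF assms] by (simp only: minus_minus mult_minus_left mult_minus_right mult_ac)
qed

text \<open>The kernel factors exchange roles. The derivative 2\<pi>i\<tau> in the denominator and
  (m/\<tau>)^(1-2a) together give \<tau>^(2a-2); evenness replaces 1/\<tau> by -1/\<tau>, which lies
  in the upper half-plane.\<close>

lemma residue_int_over_\<tau>:
  assumes "m \<noteq> 0"
  shows "residue integrand (of_int m / \<tau>) =
           - (\<tau> powi (2 * a - 2)) * (calE_term a x (- 1 / \<tau>) m + calE_term a x (- 1 / \<tau>) (-m)) / (2 * of_real pi * \<i>)"
proof -
  let ?S = "{w. exp (2 * of_real pi * \<i> * w) \<noteq> 1}"
  let ?H = "\<lambda>w. w powi (1 - 2 * a) * kern x (2 * of_real pi * \<i> * w)"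
  have "open ?S" by (intro open_Collect_neq continuous_intros)
  moreover have "of_int m / \<tau> \<in> ?S"
  proof
    show "exp (2 * of_real pi * \<i> * (of_int m / \<tau>)) \<noteq> 1"
    proof
      assume "exp (2 * of_real pi * \<i> * (of_int m / \<tau>)) = 1"
      then obtain n :: int where "of_int m / \<tau> = of_int n"
        unfolding exp_2pi_i_eq_1_iff by blast
      hence "of_int m = \<tau> * of_int n" using \<tau>_nz by (simp add: field_simps)
      moreover from this have "Im (\<tau> * of_int n) = 0" by (metis complex_Im_of_int)
      ultimately show False using \<tau> assms by auto
    qed
  qed
  moreover have "?H holomorphic_on ?S"
    by (intro holomorphic_intros kern_holomorphic) auto
  moreover have p: "2 * of_real pi * \<i> * \<tau> * (of_int m / \<tau>) = 2 * of_real pi * \<i> * of_int m"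
    using \<tau>_nz by simp
  moreover have "exp (2 * of_real pi * \<i> * of_int m) = 1" by (auto simp: exp_2pi_i_eq_1_iff)
  moreover have "2 * of_real pi * \<i> * \<tau> \<noteq> 0" using \<tau>_nz by simp
  ultimately have "residue (\<lambda>w. ?H w * kern x (2 * of_real pi * \<i> * \<tau> * w)) (of_int m / \<tau>) =
      ?H (of_int m / \<tau>) *
      (exp (- of_real x * (2 * of_real pi * \<i> * \<tau> * (of_int m / \<tau>))) -
       exp (of_real x * (2 * of_real pi * \<i> * \<tau> * (of_int m / \<tau>)))) /
      (2 * of_real pi * \<i> * \<tau>)"
    by (intro residue_times_kern[where S = ?S]) (simp_all only: not_False_eq_True)
  moreover have "integrand = (\<lambda>w. ?H w * kern x (2 * of_real pi * \<i> * \<tau> * w))"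
    by (simp add: integrand_def fun_eq_iff mult_ac)
  ultimately have "residue integrand (of_int m / \<tau>) = ((of_int m / \<tau>) powi (1 - 2 * a) / \<tau>) *
      kern x (2 * of_real pi * \<i> * (of_int m / \<tau>)) *
      (exp (- of_real x * (2 * of_real pi * \<i> * of_int m)) - exp (of_real x * (2 * of_real pi * \<i> * of_int m))) /
      (2 * of_real pi * \<i>)"
    unfolding p by (simp add: mult_ac)
  moreover have "kern x (2 * of_real pi * \<i> * (- 1 / \<tau>) * of_int m) = kern x (2 * of_real pi * \<i> * (of_int m / \<tau>))"
    using kern_minus[of x "2 * of_real pi * \<i> * (of_int m / \<tau>)"] by simp
  moreover have "(of_int m / \<tau>) powi (1 - 2 * a) / \<tau> = \<tau> powi (2 * a - 2) * of_int m powi (1 - 2 * a)"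
  proof -
    have "\<tau> powi (2 * a - 1) = \<tau> powi (2 * a - 2) * \<tau>"
      using power_int_add_1[of \<tau> "2 * a - 2"] \<tau>_nz by simp
    moreover have "\<tau> powi (1 - 2 * a) = inverse (\<tau> powi (2 * a - 1))"
      by (simp flip: power_int_minus)
    ultimately show ?thesis using \<tau>_nz by (simp add: power_int_divide_distrib field_simps)
  qed
  ultimately show ?thesis
    unfolding calE_term_reflect[OF assms] by (simp only: minus_minus mult_minus_left mult_minus_right mult_ac)
qed

lemma integrand_holomorphic:
  "integrand holomorphic_on {w. exp (2 * of_real pi * \<i> * w) \<noteq> 1 \<and> exp (2 * of_real pi * \<i> * \<tau> * w) \<noteq> 1}"
  unfolding integrand_def by (intro holomorphic_intros kern_holomorphic) auto

lemma in_box_corner_iff: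
  "w \<in> box (- corner N) (corner N) \<longleftrightarrow>
     \<bar>Re w\<bar> < real (L N) + 1 / 2 \<and> \<bar>Im w\<bar> < h * (real N + 1 / 2)"
  unfolding in_box_complex_iff by (auto simp: corner_def L_half[symmetric])

lemma in_cbox_corner_iff:
  "w \<in> cbox (- corner N) (corner N) \<longleftrightarrow>
     \<bar>Re w\<bar> \<le> real (L N) + 1 / 2 \<and> \<bar>Im w\<bar> \<le> h * (real N + 1 / 2)"
  unfolding in_cbox_complex_iff by (auto simp: corner_def L_half[symmetric])

lemma corner_le: "Re (- corner N) \<le> Re (corner N)" "Im (- corner N) \<le> Im (corner N)"
  using h_pos by (simp_all add: corner_def)

text \<open>The bounds describe a rectangle larger than the contour, so that the residue theorem has
  an open neighbourhood to work in. They stop at the next integer index; being strict, they admit no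
  further pole.\<close>

lemma pole_cases:
  assumes "exp (2 * of_real pi * \<i> * w) = 1 \<or> exp (2 * of_real pi * \<i> * \<tau> * w) = 1"
    and "\<bar>Re w\<bar> < real (L N) + 1" "\<bar>Im w\<bar> < h * (real N + 1)"
  obtains n :: int where "w = of_int n" "\<bar>n\<bar> \<le> int (L N)"
        | m :: int where "w = of_int m / \<tau>" "\<bar>m\<bar> \<le> int N"
  using assms(1)
proof
  assume "exp (2 * of_real pi * \<i> * w) = 1"
  then obtain n :: int where n: "w = of_int n" by (auto simp: exp_2pi_i_eq_1_iff)
  hence "\<bar>real_of_int n\<bar> < real (L N) + 1" using assms(2) by simp
  hence "\<bar>n\<bar> \<le> int (L N)" by linarith
  with n show ?thesis by (rule that(1))
next
  assume "exp (2 * of_real pi * \<i> * \<tau> * w) = 1"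
  then obtain m :: int where "\<tau> * w = of_int m"
    using exp_2pi_i_eq_1_iff[of "\<tau> * w"] by (auto simp: mult.assoc)
  hence m: "w = of_int m / \<tau>" using \<tau>_nz by (simp add: field_simps)
  have "Im w = of_int m * Im (1 / \<tau>)" by (simp add: m Im_divide)
  hence "\<bar>Im w\<bar> = h * \<bar>of_int m\<bar>" using h_pos by (simp add: h_def abs_mult)
  hence "\<bar>real_of_int m\<bar> < real N + 1" using assms(3) h_pos by simp
  hence "\<bar>m\<bar> \<le> int N" by linarith
  with m show ?thesis by (rule that(2))
qed

lemma int_in_box: "\<bar>n\<bar> \<le> int (L N) \<Longrightarrow> of_int n \<in> box (- corner N) (corner N)"
  using h_pos unfolding in_box_corner_iff by simp

lemma int_over_\<tau>_in_box:
  assumes "\<bar>m\<bar> \<le> int N"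
  shows "of_int m / \<tau> \<in> box (- corner N) (corner N)"
proof -
  have "Im (of_int m / \<tau>) = of_int m * Im (1 / \<tau>)" "Re (of_int m / \<tau>) = of_int m * Re (1 / \<tau>)"
    by (simp_all add: Im_divide Re_divide)
  hence eq: "\<bar>Im (of_int m / \<tau>)\<bar> = h * \<bar>of_int m\<bar>" "\<bar>Re (of_int m / \<tau>)\<bar> = \<bar>Re (1 / \<tau>)\<bar> * \<bar>of_int m\<bar>"
    using h_pos by (simp_all add: h_def abs_mult)
  have m: "\<bar>real_of_int m\<bar> < real N + 1 / 2" using assms by linarith
  have "\<bar>Re (1 / \<tau>)\<bar> * \<bar>of_int m\<bar> \<le> (2 * real k + 1) * \<bar>of_int m\<bar>"
    using k_bound by (intro mult_right_mono) auto
  also have "\<dots> < (2 * real k + 1) * (real N + 1 / 2)"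
    using m by (intro mult_strict_left_mono) auto
  finally show ?thesis using m h_pos unfolding in_box_corner_iff eq L_half by simp
qed

text \<open>Every pole in the enlarged rectangle already lies in the open box, hence off its
  boundary.\<close>

lemma path_image_no_poles:
  "path_image (rectpath (- corner N) (corner N)) \<subseteq>
     {w. exp (2 * of_real pi * \<i> * w) \<noteq> 1 \<and> exp (2 * of_real pi * \<i> * \<tau> * w) \<noteq> 1}"
proof (intro subsetI CollectI, rule ccontr)
  fix w assume w: "w \<in> path_image (rectpath (- corner N) (corner N))"
    and "\<not> (exp (2 * of_real pi * \<i> * w) \<noteq> 1 \<and> exp (2 * of_real pi * \<i> * \<tau> * w) \<noteq> 1)"
  hence pole: "exp (2 * of_real pi * \<i> * w) = 1 \<or> exp (2 * of_real pi * \<i> * \<tau> * w) = 1" by blast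
  have w: "w \<in> cbox (- corner N) (corner N)" "w \<notin> box (- corner N) (corner N)"
    using w unfolding path_image_rectpath_cbox_minus_box[OF corner_le] by auto
  have "h * (real N + 1 / 2) < h * (real N + 1)" using h_pos by simp
  hence "\<bar>Re w\<bar> < real (L N) + 1" "\<bar>Im w\<bar> < h * (real N + 1)"
    using w(1) unfolding in_cbox_corner_iff by linarith+
  from pole_cases[OF pole this] show False
    by (metis w(2) int_in_box int_over_\<tau>_in_box)
qed

lemma contour_integral_eq:
  "contour_integral (rectpath (- corner N) (corner N)) integrand =
     2 * pi * \<i> * residue integrand 0
     - 2 * (\<Sum>n\<in>{-int (L N)..int (L N)} - {0}. calE_term a x \<tau> n)
     - 2 * \<tau> powi (2 * a - 2) * (\<Sum>m\<in>{-int N..int N} - {0}. calE_term a x (- 1 / \<tau>) m)"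
proof -
  define A where "A = {-int (L N)..int (L N)} - {0}"
  define A' where "A' = {-int N..int N} - {0}"
  define I where "I = (of_int ` A :: complex set)"
  define J where "J = (\<lambda>m. of_int m / \<tau>) ` A'"
  define corner' where "corner' = Complex (real (L N) + 1) (h * (real N + 1))"
  define S where "S = box (- corner') corner'"
  have S: "w \<in> S \<longleftrightarrow> \<bar>Re w\<bar> < real (L N) + 1 \<and> \<bar>Im w\<bar> < h * (real N + 1)" for w
    by (auto simp: S_def corner'_def in_box_complex_iff)
  have "cbox (- corner N) (corner N) \<subseteq> S"
  proof
    fix w assume "w \<in> cbox (- corner N) (corner N)"
    moreover have "h * (real N + 1 / 2) < h * (real N + 1)" using h_pos by simp
    ultimately show "w \<in> S" unfolding S in_cbox_corner_iff by linarith
  qed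
  have poles: "w \<in> insert 0 (I \<union> J)"
    if "w \<in> S" "exp (2 * of_real pi * \<i> * w) = 1 \<or> exp (2 * of_real pi * \<i> * \<tau> * w) = 1" for w
  proof (rule pole_cases[OF that(2)])
    show "\<bar>Re w\<bar> < real (L N) + 1" "\<bar>Im w\<bar> < h * (real N + 1)" using that(1) unfolding S by auto
  next
    fix n :: int assume w: "w = of_int n" "\<bar>n\<bar> \<le> int (L N)"
    hence "n = 0 \<or> n \<in> A" by (auto simp: A_def)
    thus ?thesis using w(1) by (auto simp: I_def)
  next
    fix m :: int assume w: "w = of_int m / \<tau>" "\<bar>m\<bar> \<le> int N"
    hence "m = 0 \<or> m \<in> A'" by (auto simp: A'_def)
    thus ?thesis using w(1) by (auto simp: J_def)
  qed
  have inside: "w \<in> box (- corner N) (corner N)" if "w \<in> insert 0 (I \<union> J)" for w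
    using that int_in_box[of _ N] int_in_box[of 0 N] int_over_\<tau>_in_box[of _ N]
    by (auto simp: I_def J_def A_def A'_def)
  have "contour_integral (rectpath (- corner N) (corner N)) integrand =
          2 * pi * \<i> * (\<Sum>p\<in>insert 0 (I \<union> J). winding_number (rectpath (- corner N) (corner N)) p * residue integrand p)"
  proof (rule Residue_theorem[where S = S])
    show "open S" "connected S" by (simp_all add: S_def open_box convex_connected convex_box)
    show "finite (insert 0 (I \<union> J))" by (simp add: I_def J_def A_def A'_def)
    show "integrand holomorphic_on S - insert 0 (I \<union> J)"
      by (rule holomorphic_on_subset[OF integrand_holomorphic]) (use poles in blast)
    show "path_image (rectpath (- corner N) (corner N)) \<subseteq> S - insert 0 (I \<union> J)"
      unfolding path_image_rectpath_cbox_minus_box[OF corner_le] using inside \<open>cbox (- corner N) (corner N) \<subseteq> S\<close> by blast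
    show "\<forall>z. z \<notin> S \<longrightarrow> winding_number (rectpath (- corner N) (corner N)) z = 0"
      using winding_number_rectpath_outside[OF corner_le] \<open>cbox (- corner N) (corner N) \<subseteq> S\<close> by blast
  qed auto
  also have "(\<Sum>p\<in>insert 0 (I \<union> J). winding_number (rectpath (- corner N) (corner N)) p * residue integrand p) =
               (\<Sum>p\<in>insert 0 (I \<union> J). residue integrand p)"
    by (intro sum.cong refl) (simp add: winding_number_rectpath[OF inside])
  also have "\<dots> = residue integrand 0 + ((\<Sum>p\<in>I. residue integrand p) + (\<Sum>p\<in>J. residue integrand p))"
  proof -
    \<comment> \<open>A common pole would make \<tau> times a nonzero integer real.\<close>
    have "I \<inter> J = {}"
    proof -
      have False if "n \<noteq> 0" "of_int n = of_int m / \<tau>" for n m :: int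
      proof -
        have "\<tau> * of_int n = of_int m" using that \<tau>_nz by (simp add: field_simps)
        hence "Im (\<tau> * of_int n) = 0" by simp
        thus False using \<tau> that(1) by simp
      qed
      thus ?thesis by (auto simp: I_def J_def A_def)
    qed
    moreover have "0 \<notin> I \<union> J" using \<tau>_nz by (auto simp: I_def J_def A_def A'_def)
    moreover have "finite I" "finite J" by (auto simp: I_def J_def A_def A'_def)
    ultimately show ?thesis by (simp add: sum.union_disjoint)
  qed
  also have "(\<Sum>p\<in>I. residue integrand p) = (\<Sum>n\<in>A. residue integrand (of_int n))"
    unfolding I_def by (subst sum.reindex) (auto simp: inj_on_def)
  also have "\<dots> = (\<Sum>n\<in>A. - (calE_term a x \<tau> n + calE_term a x \<tau> (-n)) / (2 * of_real pi * \<i>))"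
    by (intro sum.cong refl residue_int) (auto simp: A_def)
  \<comment> \<open>The index set is symmetric, so pairing n with -n counts each term twice.\<close>
  also have "\<dots> = - (2 * (\<Sum>n\<in>A. calE_term a x \<tau> n)) / (2 * of_real pi * \<i>)"
    unfolding A_def by (simp only: sum_divide_distrib[symmetric] sum_negf sum_reflect_symmetric)
  also have "(\<Sum>p\<in>J. residue integrand p) = (\<Sum>m\<in>A'. residue integrand (of_int m / \<tau>))"
    unfolding J_def by (subst sum.reindex) (use \<tau>_nz in \<open>auto simp: inj_on_def\<close>)
  also have "\<dots> = (\<Sum>m\<in>A'. - (\<tau> powi (2 * a - 2)) * (calE_term a x (- 1 / \<tau>) m + calE_term a x (- 1 / \<tau>) (-m)) / (2 * of_real pi * \<i>))"
    by (intro sum.cong refl residue_int_over_\<tau>) (auto simp: A'_def)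
  also have "\<dots> = - (\<tau> powi (2 * a - 2)) * (2 * (\<Sum>m\<in>A'. calE_term a x (- 1 / \<tau>) m)) / (2 * of_real pi * \<i>)"
    unfolding A'_def by (simp only: sum_divide_distrib[symmetric] sum_distrib_left[symmetric] sum_reflect_symmetric)
  finally have eq: "contour_integral (rectpath (- corner N) (corner N)) integrand = 2 * of_real pi * \<i> *
      (residue integrand 0 + (- (2 * (\<Sum>n\<in>A. calE_term a x \<tau> n)) / (2 * of_real pi * \<i>) +
        - (\<tau> powi (2 * a - 2)) * (2 * (\<Sum>m\<in>A'. calE_term a x (- 1 / \<tau>) m)) / (2 * of_real pi * \<i>)))"
    by simp
  have "c * (r + (- (2 * s) / c + - t * (2 * s') / c)) = c * r - 2 * s - 2 * t * s'"
    if "c \<noteq> 0" for c r s t s' :: complex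
    using that by (simp add: field_simps)
  note expand = this
  show ?thesis unfolding eq A_def A'_def by (subst expand) simp_all
qed

section \<open>Passage to the limit\<close>

lemma contour_integral_tendsto_0:
  "(\<lambda>N. contour_integral (rectpath (- corner N) (corner N)) integrand) \<longlonglongrightarrow> 0"
proof -
  define P where "P = nat \<bar>1 - 2 * a\<bar>"
  define c where "c = 2 * pi * min x (1 - x) * \<mu>"
  \<comment> \<open>The diagonal of the rectangle has length at most QM with M = N + 1/2.\<close>
  define Q where "Q = 2 * (2 * real k + 1 + h)"
  have c: "c > 0" using x \<mu>_pos by (simp add: c_def)
  obtain C where C: "C \<ge> 0"
    "\<And>N w. \<mu> * (real N + 1 / 2) \<ge> 1 \<Longrightarrow> w \<in> path_image (rectpath (- corner N) (corner N)) \<Longrightarrow>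
       norm (integrand w) \<le> C * ((real N + 1 / 2) ^ P * exp (- c * (real N + 1 / 2)))"
    unfolding P_def c_def using norm_integrand_boundary_le by blast
  have M: "filterlim (\<lambda>N. real N + 1 / 2) at_top sequentially"
    using filterlim_tendsto_add_at_top[OF tendsto_const filterlim_real_sequentially, of "1 / 2"]
    by (simp add: add.commute)
  show ?thesis
  proof (rule Lim_null_comparison)
    have "eventually (\<lambda>N. real N + 1 / 2 \<ge> 1 / \<mu>) sequentially"
      using M by (simp add: filterlim_at_top)
    thus "\<forall>\<^sub>F N in sequentially. norm (contour_integral (rectpath (- corner N) (corner N)) integrand) \<le>
            4 * (C * ((real N + 1 / 2) ^ P * exp (- c * (real N + 1 / 2)))) * (Q * (real N + 1 / 2))"
    proof eventually_elim
      case (elim N)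
      let ?R = "path_image (rectpath (- corner N) (corner N))"
      have large: "\<mu> * (real N + 1 / 2) \<ge> 1" using elim \<mu>_pos by (simp add: field_simps)
      have "norm (contour_integral (rectpath (- corner N) (corner N)) integrand) \<le>
              4 * (C * ((real N + 1 / 2) ^ P * exp (- c * (real N + 1 / 2)))) * norm (corner N - (- corner N))"
      proof (rule norm_contour_integral_rectpath_le)
        show "continuous_on ?R integrand"
          by (rule continuous_on_subset[OF holomorphic_on_imp_continuous_on[OF integrand_holomorphic]])
             (rule path_image_no_poles)
        show "norm (integrand z) \<le> C * ((real N + 1 / 2) ^ P * exp (- c * (real N + 1 / 2)))" if "z \<in> ?R" for z
          by (rule C(2)[OF large that])
      qed (use C(1) in simp)
      also have "norm (corner N - (- corner N)) \<le> Q * (real N + 1 / 2)"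
        using cmod_le[of "corner N - (- corner N)"] h_pos by (simp add: corner_def Q_def algebra_simps)
      finally show ?case using C(1) by (simp add: mult_left_mono)
    qed
    \<comment> \<open>One power more than \<open>P\<close>, for the length of the contour.\<close>
    have "(\<lambda>N. (c * (real N + 1 / 2)) ^ Suc P / exp (c * (real N + 1 / 2))) \<longlonglongrightarrow> 0"
      by (rule filterlim_compose[OF tendsto_power_div_exp_0])
         (rule filterlim_tendsto_pos_mult_at_top[OF tendsto_const c M])
    hence "(\<lambda>N. 4 * C * Q / c ^ Suc P * ((c * (real N + 1 / 2)) ^ Suc P / exp (c * (real N + 1 / 2)))) \<longlonglongrightarrow> 4 * C * Q / c ^ Suc P * 0"
      by (intro tendsto_mult tendsto_const)
    moreover have "4 * C * Q / c ^ Suc P * ((c * M) ^ Suc P / exp (c * M)) =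
                     4 * (C * (M ^ P * exp (- c * M))) * (Q * M)" for M
      using c by (simp add: power_mult_distrib exp_minus field_simps)
    ultimately show "(\<lambda>N. 4 * (C * ((real N + 1 / 2) ^ P * exp (- c * (real N + 1 / 2)))) * (Q * (real N + 1 / 2))) \<longlonglongrightarrow> 0"
      by (simp only: mult_zero_right)
  qed
qed

text \<open>The limit of \<open>contour_integral_eq\<close>, halved. The two symmetric partial sums
  run to \<open>L N\<close> and to N; as both bounds tend to infinity, the different speeds do no
  harm.\<close>

lemma calE_term_sums_residue_0:
  assumes "(calE_term a x \<tau> has_sum s) (UNIV - {0})"
    and "(calE_term a x (- 1 / \<tau>) has_sum s') (UNIV - {0})"
  shows "s + \<tau> powi (2 * a - 2) * s' = of_real pi * \<i> * residue integrand 0"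
proof -
  have "filterlim L at_top at_top"
    by (rule filterlim_at_top_mono[OF filterlim_ident]) (auto simp: L_def)
  hence "(\<lambda>N. \<Sum>n\<in>{-int (L N)..int (L N)} - {0}. calE_term a x \<tau> n) \<longlonglongrightarrow> s"
    by (rule has_sum_imp_symmetric_partial_sums[OF assms(1)])
  moreover have "(\<lambda>N. \<Sum>m\<in>{-int N..int N} - {0}. calE_term a x (- 1 / \<tau>) m) \<longlonglongrightarrow> s'"
    by (rule has_sum_imp_symmetric_partial_sums[OF assms(2) filterlim_ident])
  ultimately have "(\<lambda>N. contour_integral (rectpath (- corner N) (corner N)) integrand) \<longlonglongrightarrow>
          2 * pi * \<i> * residue integrand 0 - 2 * s - 2 * \<tau> powi (2 * a - 2) * s'"
    unfolding contour_integral_eq by (intro tendsto_intros)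
  from LIMSEQ_unique[OF this contour_integral_tendsto_0]
  have "2 * (s + \<tau> powi (2 * a - 2) * s') = 2 * (of_real pi * \<i> * residue integrand 0)"
    by (simp add: algebra_simps)
  thus ?thesis by (rule mult_left_cancel[THEN iffD1, rotated]) simp
qed

end

theorem corollary1p4:
  fixes a :: int and x :: real and \<tau> :: complex
  assumes "0 < x" and "x < 1" and "Im \<tau> > 0"
  shows "(\<Sum>\<epsilon>\<in>{1, -1 :: complex}.
            \<epsilon> * calE (2 - 2 * a) (((1 - 2 * of_real x) * (1 + \<epsilon> * \<tau>) + \<tau> + 1) / 2) \<tau>) =
         - (\<tau> powi (2 * a - 2)) *
           (\<Sum>\<epsilon>\<in>{1, -1 :: complex}.
              \<epsilon> * calE (2 - 2 * a)
                (((1 - 2 * of_real x) * (1 - \<epsilon> * (1 / \<tau>)) - 1 / \<tau> + 1) / 2) (- 1 / \<tau>))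
         + 2 * (2 * of_real pi * \<i>) powi (2 * a - 1) *
           (\<Sum>n<nat a. of_real (bernpoly (2 * n + 1) x * bernpoly (2 * nat a - 1 - 2 * n) x)
                       / (fact (2 * n + 1) * fact (2 * nat a - 1 - 2 * n)) * \<tau> ^ (2 * n))"
    (is "?E = - _ * ?E' + 2 * _ * (\<Sum>n<nat a. ?b n * _)")
proof -
  interpret kern_contour x \<tau> a by unfold_locales (use assms in auto)
  define c where "c = 2 * of_real pi * \<i>"
  have c: "c \<noteq> 0" by (simp add: c_def)
  have "Im (- 1 / \<tau>) > 0" using h_pos by (simp add: h_def)
  from calE_term_has_sum[OF assms(1,2) this]
  have "(calE_term a x (- 1 / \<tau>) has_sum ?E') (UNIV - {0})"
    by simp
  from calE_term_sums_residue_0[OF calE_term_has_sum[OF assms] this]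
  have "?E = - (\<tau> powi (2 * a - 2)) * ?E' + c / 2 * residue integrand 0"
    by (simp add: c_def eq_diff_eq[symmetric])
  also have "residue integrand 0 = 4 * (\<Sum>n<nat a. ?b n * (c * \<tau>) ^ (2 * n) * c ^ (2 * (nat a - 1 - n)))"
    using residue_kern_kern_0[OF c, of "c * \<tau>" a x] c \<tau>_nz unfolding integrand_def[abs_def] c_def by simp
  \<comment> \<open>The substitution d = c\<tau> separates \<tau>^(2n); the powers of c add up to 1
    + 2n + 2(a-1-n) = 2a - 1, independent of n.\<close>
  also have "c / 2 * \<dots> = (\<Sum>n<nat a. 2 * c powi (2 * a - 1) * (?b n * \<tau> ^ (2 * n)))"
    unfolding sum_distrib_left
  proof (rule sum.cong)
    fix n assume n: "n \<in> {..<nat a}"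
    hence "c powi (2 * a - 1) = c ^ (2 * nat a - 1)"
      by (simp add: power_int_def nat_diff_distrib nat_mult_distrib)
    \<comment> \<open>An index n < \<open>nat a\<close> forces a \<ge> 1, so no subtraction is
      truncated.\<close>
    also have "2 * nat a - 1 = Suc (2 * n + 2 * (nat a - 1 - n))" using n by auto
    finally have "c powi (2 * a - 1) = c * (c ^ (2 * n) * c ^ (2 * (nat a - 1 - n)))"
      by (simp only: power_Suc power_add)
    thus "c / 2 * (4 * (?b n * (c * \<tau>) ^ (2 * n) * c ^ (2 * (nat a - 1 - n)))) =
            2 * c powi (2 * a - 1) * (?b n * \<tau> ^ (2 * n))"
      by (simp only: power_mult_distrib) simp
  qed auto
  also have "\<dots> = 2 * c powi (2 * a - 1) * (\<Sum>n<nat a. ?b n * \<tau> ^ (2 * n))"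
    by (rule sum_distrib_left[symmetric])
  finally show ?thesis unfolding c_def .
qed

end
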